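(* Define $$\lambda=(\lambda_k^j)_{1\le k<\infty,\ 0\le j\le 1}=(4^k+jk)_{1\le k<\infty,\ 0\le j\le 1}$$ (with $k,j$ integers), regarded as a single sequence indexed by the positive integers. Then $\lambda$ is Zygmund lacunary but not strong Zygmund lacunary.
   Context: A sequence $(\lambda_k)_{k\ge 1}\subset\mathbb{R}$ is said to be Zygmund lacunary (with constant $N$) if $$\sup_{k\neq l}\#\left\{(k',l'):\ |\lambda_k-\lambda_l-(\lambda_{k'}-\lambda_{l'})|\le 1\right\}=N<\infty.$$ A sequence $(\lambda_k)_{k=1}^\infty\subset\mathbb{R}$ is said to be strong Zygmund lacunary if there exists a function $M:\mathbb{N}\to\mathbb{N}$ such that for any $L\in\mathbb{N}$ the sequence $(\lambda_k/L)_{k\ge M(L)}$ is Zygmund lacunary with constant $N$ independent of $L$, that is, if there is $N<\infty$, not depending on $L$, such that $$\sup_{\substack{k\neq l\\ k,l\ge M(L)}}\#\left\{(k',l'):\ k',l'\ge M(L),\ |\lambda_k-\lambda_l-(\lambda_{k'}-\lambda_{l'})|\le L\right\}\le N$$ for every $L\in\mathbb{N}$.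
   Formalization: In both definitions the counted pairs (k',l') are required to satisfy k' ≠ l'; without this the claim fails, since the terms 4 and 5 differ by 1 and all pairs (k',k') would be counted. *)

theory Defs
  imports Complex_Main "HOL-Library.Extended_Nat"
begin

text \<open>Cardinality with value \<open>\<infinity>\<close> on infinite sets (\<open>card\<close> would return 0 there).\<close>

definition ecard :: "'a set \<Rightarrow> enat" where
  "ecard A = (if finite A then enat (card A) else \<infinity>)"

text \<open>
  The index pairs over which differences of terms are formed. Both the pairs \<open>(k, l)\<close> in the
  supremum and the counted pairs \<open>(k', l')\<close> below have distinct components. If the
  pairs \<open>(k', k')\<close> were counted as well, then two distinct terms at distance at most 1 would
  already make the count infinite, whatever the rest of the sequence looks like.
\<close>

definition off_diag :: "nat set \<Rightarrow> (nat \<times> nat) set" where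
  "off_diag I = {(k, l). k \<in> I \<and> l \<in> I \<and> k \<noteq> l}"

definition zygmund_const :: "nat set \<Rightarrow> (nat \<Rightarrow> real) \<Rightarrow> enat" where
  "zygmund_const I a =
     (SUP (k, l) \<in> off_diag I.
        ecard {(k', l'). (k', l') \<in> off_diag I \<and> \<bar>a k - a l - (a k' - a l')\<bar> \<le> 1})"

text \<open>Sequences are indexed by the positive integers; the value at 0 is irrelevant.\<close>

definition zygmund_lacunary :: "(nat \<Rightarrow> real) \<Rightarrow> bool" where
  "zygmund_lacunary a \<longleftrightarrow> zygmund_const {1..} a < \<infinity>"

text \<open>
  The scale \<open>L\<close> ranges over the positive integers, and \<open>M L\<close> is a positive index. Division
  by \<open>L\<close> turns the tolerance 1 into the tolerance \<open>L\<close> for the original sequence.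
\<close>

definition strong_zygmund_lacunary :: "(nat \<Rightarrow> real) \<Rightarrow> bool" where
  "strong_zygmund_lacunary a \<longleftrightarrow>
     (\<exists>(M :: nat \<Rightarrow> nat) (N :: nat). \<forall>L\<ge>1.
        M L \<ge> 1 \<and> zygmund_const {M L..} (\<lambda>k. a k / real L) \<le> enat N)"

definition block_term :: "nat \<Rightarrow> nat \<Rightarrow> real" where
  "block_term k j = 4 ^ k + real j * real k"

text \<open>
  The double sequence listed lexicographically in \<open>(k, j)\<close>, which is also the increasing order:
  \<open>4, 4 + 1, 4\<^sup>2, 4\<^sup>2 + 2, 4\<^sup>3, 4\<^sup>3 + 3, \<dots>\<close> at the positions \<open>1, 2, 3, \<dots>\<close>
\<close>

definition block_seq :: "nat \<Rightarrow> real" where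
  "block_seq n = block_term ((n + 1) div 2) ((n + 1) mod 2)"

lemma block_seq_enumerates:
  assumes "k \<ge> 1" "j \<le> 1"
  shows "block_seq (2 * (k - 1) + j + 1) = block_term k j"
proof -
  have "2 * (k - 1) + j + 1 + 1 = 2 * k + j" using assms by simp
  moreover have "(2 * k + j) div 2 = k" "(2 * k + j) mod 2 = j" using assms by auto
  ultimately show ?thesis by (simp only: block_seq_def)
qed

end

theory Submission
  imports Defs
begin

text \<open>
  All differences are integers, so being within 1 of a given difference \<open>d\<close> means being equal to
  \<open>d - 1\<close>, \<open>d\<close> or \<open>d + 1\<close>. A difference \<open>(4\<^sup>k + j k) - (4\<^sup>l + i l)\<close> with fixed \<open>j, i \<le> 1\<close> determines
  \<open>k\<close> and \<open>l\<close>: its sign tells which of the two is larger, its size then determines the larger one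
  because the terms grow geometrically, and the smaller one follows. The differences \<open>\<plusminus>k\<close> inside
  a block are injective in \<open>k\<close> as well. Hence every value is attained a bounded number of times.

  At scale \<open>L\<close>, however, the differences \<open>m, m + 1, \<dots>, m + L\<close> inside consecutive blocks all lie
  within \<open>L\<close> of \<open>m\<close>, and such blocks exist arbitrarily far out.
\<close>

lemma ecard_le_iff: "ecard A \<le> enat n \<longleftrightarrow> finite A \<and> card A \<le> n"
  by (simp add: ecard_def)

text \<open>The offset is at most \<open>k < 4 ^ k\<close>, so every term of block \<open>k\<close>
  lies below \<open>2 * 4 ^ k\<close>, and its double lies below \<open>4 ^ Suc k\<close>.\<close>

lemma block_term_Suc_gt:
  assumes "j \<le> 1"
  shows "2 * block_term k j < block_term (Suc k) i"
proof -
  have "real j * real k \<le> real k"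
    using assms by (auto intro: mult_left_le_one_le)
  also have "\<dots> < 4 ^ k"
    by (rule less_le_trans[OF of_nat_less_two_power power_mono]) auto
  finally have "2 * block_term k j < 4 ^ Suc k"
    by (simp add: block_term_def)
  also have "\<dots> \<le> block_term (Suc k) i" by (simp add: block_term_def)
  finally show ?thesis .
qed

lemma block_term_pos: "0 < block_term k j"
  by (simp add: block_term_def add_pos_nonneg)

lemma block_term_strict_mono:
  assumes "k < l"
  shows "block_term k j < block_term l j"
proof -
  have "(4::real) ^ k < 4 ^ l" using assms by simp
  moreover have "real j * real k \<le> real j * real l" using assms by (intro mult_left_mono) auto
  ultimately show ?thesis unfolding block_term_def by linarith
qed

lemma block_term_less_block:
  assumes "k < l" "j \<le> 1"
  shows "2 * block_term k j < block_term l i"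
  using block_term_Suc_gt[OF assms(2), of k i] block_term_strict_mono[of "Suc k" l i] assms(1)
  by (cases "Suc k = l") auto

lemma block_term_eq_iff: "block_term k j = block_term l j \<longleftrightarrow> k = l"
  using block_term_strict_mono[of k l j] block_term_strict_mono[of l k j]
  by (cases k l rule: linorder_cases) auto

text \<open>Both \<open>block_term k j\<close> and \<open>block_term l' i\<close> are less than half
  of \<open>block_term k' j\<close>, so their sum is below it; this is where the factor 2 in the
  growth is used.\<close>

lemma block_diff_less:
  assumes "l < k" "k < k'" "l' < k'" "j \<le> 1" "i \<le> 1"
  shows "block_term k j - block_term l i < block_term k' j - block_term l' i"
proof -
  have "2 * block_term k j < block_term k' j" "2 * block_term l' i < block_term k' j"
    using assms block_term_less_block by auto
  then show ?thesis using block_term_pos[of l i] by linarith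
qed

lemma block_diff_inj_ordered:
  assumes "l < k" "l' < k'" "j \<le> 1" "i \<le> 1"
    and eq: "block_term k j - block_term l i = block_term k' j - block_term l' i"
  shows "k = k' \<and> l = l'"
proof -
  have "k = k'"
    using block_diff_less[of l k k' l' j i] block_diff_less[of l' k' k l j i] assms
    by (cases k k' rule: linorder_cases) auto
  with eq show ?thesis by (simp add: block_term_eq_iff)
qed

lemma block_diff_inj:
  assumes "k \<noteq> l" "k' \<noteq> l'" "j \<le> 1" "i \<le> 1"
    and eq: "block_term k j - block_term l i = block_term k' j - block_term l' i"
  shows "k = k' \<and> l = l'"
proof -
  \<comment> \<open>The sign of a difference reveals which block index is larger, which rules out
    the two mixed cases. If both differences are negative, negating \<open>eq\<close> swaps the
    roles of \<open>j\<close> and \<open>i\<close>.\<close>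
  have pos: "0 < block_term k j - block_term l i" if "l < k" "i \<le> 1" for k l i j
    using block_term_less_block[OF that, of j] block_term_pos[of l i] by linarith
  consider "l < k" "l' < k'" | "k < l" "k' < l'" | "l < k" "k' < l'" | "k < l" "l' < k'"
    using assms(1,2) by linarith
  then show ?thesis
  proof cases
    case 1
    then show ?thesis using block_diff_inj_ordered assms by blast
  next
    case 2
    moreover have "block_term l i - block_term k j = block_term l' i - block_term k' j"
      using eq by linarith
    ultimately show ?thesis using block_diff_inj_ordered assms by blast
  next
    case 3
    then show ?thesis using pos[of l k i j] pos[of k' l' j i] assms by linarith
  next
    case 4
    then show ?thesis using pos[of k l j i] pos[of l' k' i j] assms by linarith
  qed
qed

text \<open>Inside one block the powers of 4 cancel and the difference is
  \<open>(j - i) * k\<close>, linear in \<open>k\<close>.\<close>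

lemma block_diff_inj_diag:
  assumes "j \<noteq> i"
    and "block_term k j - block_term k i = block_term k' j - block_term k' i"
  shows "k = k'"
proof -
  have "(real j - real i) * real k = (real j - real i) * real k'"
    using assms(2) by (simp add: block_term_def algebra_simps)
  with assms(1) show ?thesis by simp
qed

lemma block_diff_multiplicity:
  fixes x :: real
  defines "A \<equiv> {(p, q). (p, q) \<in> off_diag {1..} \<and> block_seq p - block_seq q = x}"
  shows "finite A" "card A \<le> 8"
proof -
  define idx where "idx n = (n + 1) div 2" for n :: nat
  define par where "par n = (n + 1) mod 2" for n :: nat
  have dec: "p = q" if "idx p = idx q" "par p = par q" for p q
  proof -
    have "p + 1 = q + 1" using that unfolding idx_def par_def by (metis div_mult_mod_eq)
    then show ?thesis by simp
  qed
  have seq: "block_seq n = block_term (idx n) (par n)" for n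
    by (simp add: block_seq_def idx_def par_def)
  have par_le: "par n \<le> 1" for n by (simp add: par_def)
  \<comment> \<open>The two parities fix \<open>j\<close> and \<open>i\<close>, and the flag selects
    the injectivity statement that applies: across blocks or inside one. Three booleans give the
    bound \<open>8 = 2 ^ 3\<close>.\<close>
  define h where "h = (\<lambda>(p, q). (even p, even q, idx p = idx q))"
  have inj: "inj_on h A"
  proof (rule inj_onI, clarify)
    fix p q p' q'
    assume A: "(p, q) \<in> A" "(p', q') \<in> A" and h: "h (p, q) = h (p', q')"
    have par: "par p' = par p" "par q' = par q" and
      flag: "idx p = idx q \<longleftrightarrow> idx p' = idx q'"
      using h by (auto simp: h_def par_def mod2_eq_if)
    have eq: "block_term (idx p) (par p) - block_term (idx q) (par q)
              = block_term (idx p') (par p) - block_term (idx q') (par q)"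
      using A by (simp add: A_def seq par)
    have "idx p = idx p' \<and> idx q = idx q'"
    proof (cases "idx p = idx q")
      case True
      \<comment> \<open>Distinct positions in the same block must differ in parity, so the
        difference is a nonzero multiple of the block index.\<close>
      moreover have "par p \<noteq> par q" using A dec True by (auto simp: A_def off_diag_def)
      ultimately show ?thesis using block_diff_inj_diag[of "par p" "par q"] eq flag by metis
    next
      case False
      then show ?thesis using block_diff_inj eq flag par_le by blast
    qed
    then show "p = p' \<and> q = q'" using dec par by metis
  qed
  show "finite A" using inj by (rule inj_on_finite[where B = UNIV]) auto
  show "card A \<le> 8"
    using card_inj_on_le[OF inj subset_UNIV finite]
    by (simp add: card_UNIV_bool card_cartesian_product flip: UNIV_Times_UNIV)
qed

lemma block_seq_in_Ints: "block_seq n \<in> \<int>"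
  by (simp add: block_seq_def block_term_def)

lemma Ints_abs_le_1:
  fixes x :: real
  assumes "x \<in> \<int>" "\<bar>x\<bar> \<le> 1"
  shows "x \<in> {-1, 0, 1}"
proof -
  obtain z where z: "x = of_int z" using assms(1) by (rule Ints_cases)
  then have "\<bar>z\<bar> \<le> 1" using assms(2) by linarith
  then have "z = -1 \<or> z = 0 \<or> z = 1" by linarith
  then show ?thesis using z by auto
qed

lemma block_seq_zygmund_lacunary: "zygmund_lacunary block_seq"
proof -
  define A where
    "A x = {(p, q). (p, q) \<in> off_diag {1..} \<and> block_seq p - block_seq q = x}" for x
  \<comment> \<open>The constant is \<open>24 = 3 * 8\<close>: three admissible integer values, each
    attained by at most 8 pairs.\<close>
  have "ecard {(k', l'). (k', l') \<in> off_diag {1..} \<and>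
          \<bar>block_seq k - block_seq l - (block_seq k' - block_seq l')\<bar> \<le> 1} \<le> enat 24"
    (is "ecard ?S \<le> _") for k l
  proof -
    let ?d = "block_seq k - block_seq l"
    have sub: "?S \<subseteq> A (?d + 1) \<union> A ?d \<union> A (?d - 1)"
    proof clarify
      fix k' l'
      assume *: "(k', l') \<in> off_diag {1..}"
        "\<bar>block_seq k - block_seq l - (block_seq k' - block_seq l')\<bar> \<le> 1"
        "(k', l') \<notin> A (?d - 1)" "(k', l') \<notin> A ?d"
      have "?d - (block_seq k' - block_seq l') \<in> {-1, 0, 1}"
        using *(2) by (intro Ints_abs_le_1 Ints_diff block_seq_in_Ints)
      with * show "(k', l') \<in> A (?d + 1)" by (auto simp: A_def)
    qed
    have fin: "finite (A x)" and card: "card (A x) \<le> 8" for x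
      using block_diff_multiplicity[of x] by (auto simp: A_def)
    have "card ?S \<le> card (A (?d + 1) \<union> A ?d \<union> A (?d - 1))"
      using sub fin by (intro card_mono) auto
    also have "\<dots> \<le> card (A (?d + 1)) + card (A ?d) + card (A (?d - 1))"
      using card_Un_le[of "A (?d + 1) \<union> A ?d" "A (?d - 1)"]
        card_Un_le[of "A (?d + 1)" "A ?d"] by linarith
    also have "\<dots> \<le> 24"
      using card[of "?d + 1"] card[of ?d] card[of "?d - 1"] by linarith
    finally have "card ?S \<le> 24" .
    moreover have "finite ?S" using sub fin by (auto intro: finite_subset)
    ultimately show ?thesis by (simp add: ecard_le_iff)
  qed
  then have "zygmund_const {1..} block_seq \<le> enat 24"
    unfolding zygmund_const_def by (intro SUP_least) auto
  then have "zygmund_const {1..} block_seq < \<infinity>" by (rule le_less_trans) simp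
  then show ?thesis by (simp only: zygmund_lacunary_def)
qed

text \<open>Positions \<open>2 * m - 1\<close> and \<open>2 * m\<close> hold the terms
  \<open>j = 0\<close> and \<open>j = 1\<close> of block \<open>m\<close>.\<close>

lemma block_seq_gap:
  assumes "m \<ge> 1"
  shows "block_seq (2 * m) - block_seq (2 * m - 1) = real m"
  using block_seq_enumerates[of m 0] block_seq_enumerates[of m 1] assms
  by (cases m) (simp_all add: block_term_def)

text \<open>The reference pair is block \<open>M\<close> itself, whose positions are at least
  \<open>M\<close> because \<open>M \<ge> 1\<close>. The blocks \<open>M\<close> to
  \<open>M + L\<close> supply \<open>L + 1\<close> counted pairs, one more than
  \<open>L\<close>.\<close>

lemma zygmund_const_block_seq_scaled_gt:
  assumes "L \<ge> 1" "M \<ge> 1"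
  shows "enat L < zygmund_const {M..} (\<lambda>k. block_seq k / real L)"
proof -
  define gap :: "nat \<Rightarrow> nat \<times> nat" where "gap m = (2 * m, 2 * m - 1)" for m
  define S where "S = {(k', l'). (k', l') \<in> off_diag {M..} \<and>
    \<bar>block_seq (2 * M) / real L - block_seq (2 * M - 1) / real L
      - (block_seq k' / real L - block_seq l' / real L)\<bar> \<le> 1}"
  have off: "gap m \<in> off_diag {M..}" if "m \<ge> M" for m
    using that assms by (auto simp: gap_def off_diag_def)
  have sub: "gap ` {M..M + L} \<subseteq> S"
  proof
    fix x assume "x \<in> gap ` {M..M + L}"
    then obtain m where m: "x = gap m" "M \<le> m" "m \<le> M + L" by auto
    have quot: "block_seq (2 * n) / real L - block_seq (2 * n - 1) / real L = real n / real L"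
      if "n \<ge> 1" for n
      using block_seq_gap[OF that] by (simp flip: diff_divide_distrib)
    have "\<bar>real M / real L - real m / real L\<bar> \<le> 1"
      using m assms by (simp flip: diff_divide_distrib)
    then show "x \<in> S"
      using off[of m] m quot[of M] quot[of m] assms by (simp add: S_def gap_def)
  qed
  have "card (gap ` {M..M + L}) = L + 1"
    by (subst card_image) (auto simp: inj_on_def gap_def)
  \<comment> \<open>This form also covers an infinite \<open>S\<close>, for which
    \<open>ecard S\<close> is infinite.\<close>
  then have "\<not> (finite S \<and> card S \<le> L)" using card_mono[OF _ sub] by auto
  then have "enat L < ecard S" by (metis ecard_le_iff not_le)
  also have "\<dots> \<le> zygmund_const {M..} (\<lambda>k. block_seq k / real L)"
    unfolding zygmund_const_def S_def using off[of M]
    by (intro SUP_upper2[where i = "gap M"]) (auto simp: gap_def)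
  finally show ?thesis .
qed

lemma block_seq_not_strong_zygmund_lacunary: "\<not> strong_zygmund_lacunary block_seq"
proof
  assume "strong_zygmund_lacunary block_seq"
  then obtain M N where *: "\<And>L. L \<ge> 1 \<Longrightarrow> M L \<ge> 1 \<and>
      zygmund_const {M L..} (\<lambda>k. block_seq k / real L) \<le> enat N"
    unfolding strong_zygmund_lacunary_def by blast
  \<comment> \<open>Any scale above \<open>N\<close> contradicts the uniform bound, wherever
    \<open>M L\<close> starts the tail.\<close>
  define L where "L = Suc N"
  have L: "L \<ge> 1" by (simp add: L_def)
  have "enat L < zygmund_const {M L..} (\<lambda>k. block_seq k / real L)"
    using zygmund_const_block_seq_scaled_gt[OF L] *[OF L] by blast
  also have "\<dots> \<le> enat N" using *[OF L] by blast
  finally have "L < N" by simp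
  then show False by (simp add: L_def)
qed

theorem proposition3p2:
  shows "zygmund_lacunary block_seq \<and> \<not> strong_zygmund_lacunary block_seq"
  using block_seq_zygmund_lacunary block_seq_not_strong_zygmund_lacunary by blast

end
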